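(* Let $m$ and $n$ be positive integers and $d=\gcd(m,n)$. Then $T_n(x)-T_m(y)$ is irreducible in $\mathbb{R}[x,y]$ if and only if $d=1$, and $T_n(x)+T_m(y)$ is irreducible in $\mathbb{R}[x,y]$ if and only if $d\leq 2$.
   Context: For a nonnegative integer $k$, $T_k$ denotes the $k$-th Chebyshev polynomial of the first kind, i.e. the unique polynomial with $T_k(\cos\theta)=\cos k\theta$ for all real $\theta$. *)

theory Defs
  imports Complex_Main "HOL-Computational_Algebra.Computational_Algebra"
begin

definition chebyshev_T :: "nat \<Rightarrow> real poly" where
  "chebyshev_T k = (THE p. \<forall>\<theta>. poly p (cos \<theta>) = cos (real k * \<theta>))"

lemma chebyshev_T_exists: "\<exists>p :: real poly. \<forall>\<theta>. poly p (cos \<theta>) = cos (real k * \<theta>)"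
proof (induction k rule: less_induct)
  case (less k)
  consider "k = 0" | "k = 1" | j where "k = Suc (Suc j)"
    by (metis One_nat_def not0_implies_Suc)
  then show ?case
  proof cases
    case 1
    then show ?thesis by (intro exI[of _ 1]) simp
  next
    case 2
    then show ?thesis by (intro exI[of _ "[:0, 1:]"]) simp
  next
    case 3
    obtain p q :: "real poly"
      where p: "\<forall>\<theta>. poly p (cos \<theta>) = cos (real (Suc j) * \<theta>)"
        and q: "\<forall>\<theta>. poly q (cos \<theta>) = cos (real j * \<theta>)"
      using less.IH[of "Suc j"] less.IH[of j] 3 by auto
    have "poly ([:0, 2:] * p - q) (cos \<theta>) = cos (real k * \<theta>)" for \<theta>
    proof -
      have "cos (real k * \<theta>) + cos (real j * \<theta>)
          = cos (real (Suc j) * \<theta> + \<theta>) + cos (real (Suc j) * \<theta> - \<theta>)"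
        by (simp add: 3 algebra_simps)
      also have "\<dots> = 2 * cos \<theta> * cos (real (Suc j) * \<theta>)"
        unfolding cos_add cos_diff by (rule trans[OF _ mult.commute]) simp
      finally show ?thesis using p q by (simp add: algebra_simps)
    qed
    then show ?thesis by blast
  qed
qed

lemma chebyshev_T_unique:
  fixes p q :: "real poly"
  assumes "\<forall>\<theta>. poly p (cos \<theta>) = cos (real k * \<theta>)"
    and "\<forall>\<theta>. poly q (cos \<theta>) = cos (real k * \<theta>)"
  shows "p = q"
proof (rule ccontr)
  assume "p \<noteq> q"
  then have "finite {x. poly (p - q) x = 0}"
    by (intro poly_roots_finite) simp
  moreover have "{-1..1} \<subseteq> {x. poly (p - q) x = 0}"
  proof
    fix x :: real assume "x \<in> {-1..1}"
    then have "cos (arccos x) = x" by simp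
    then show "x \<in> {x. poly (p - q) x = 0}"
      using assms by (metis (mono_tags) diff_self mem_Collect_eq poly_diff)
  qed
  ultimately have "finite {-1..1::real}" by (rule rev_finite_subset)
  then show False using infinite_Icc[of "-1::real" 1] by simp
qed

lemma poly_chebyshev_T_cos: "poly (chebyshev_T k) (cos \<theta>) = cos (real k * \<theta>)"
proof -
  have "\<exists>!p :: real poly. \<forall>\<theta>. poly p (cos \<theta>) = cos (real k * \<theta>)"
    using chebyshev_T_exists chebyshev_T_unique by blast
  from theI'[OF this] show ?thesis
    unfolding chebyshev_T_def by blast
qed

text \<open>
  The ring \<open>\<real>[x,y]\<close> is represented as \<open>\<real>[x][y]\<close>, i.e. by the type \<^typ>\<open>real poly poly\<close>,
  with the inner indeterminate as \<open>x\<close> and the outer one as \<open>y\<close>.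
\<close>

definition var_x :: "real poly poly" where
  "var_x = [:[:0, 1:]:]"

definition var_y :: "real poly poly" where
  "var_y = [:0, 1:]"

text \<open>\<open>subst2 p q\<close> is \<open>p(q)\<close>, the value of a univariate polynomial at an element of \<open>\<real>[x,y]\<close>.\<close>

definition subst2 :: "real poly \<Rightarrow> real poly poly \<Rightarrow> real poly poly" where
  "subst2 p q = poly (map_poly (\<lambda>c. [:[:c:]:]) p) q"

lemma poly_subst2: "poly (poly (subst2 p q) [:b:]) a = poly p (poly (poly q [:b:]) a)"
  unfolding subst2_def by (induction p) (simp_all add: map_poly_pCons)

lemma subst2_var_x: "subst2 p var_x = [:p:]"
  unfolding subst2_def var_x_def by (induction p) (simp_all add: map_poly_pCons)

lemma subst2_var_y: "subst2 p var_y = map_poly (\<lambda>c. [:c:]) p"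
  unfolding subst2_def var_y_def by (induction p) (simp_all add: map_poly_pCons)

end

(*
Suppose F = f(x) + g(y) = G H, and let k be the y-degree of G and j the degree of G(x, y0). On the
curve x = t^m, y = y0 + alpha t^n with m = deg g, n = deg f and alpha generic, G has degree at least
n k and m j, while the degrees of G and H add up to at most n m; counting forces n k = m j. If
gcd(m, n) = 1 this gives k = 0 or k = m. If gcd(m, n) = 2 and both polynomials have suitable lines
without real points of F = 0, then k and j are even, which again forces k = 0 or k = m; for
T_n(x) + T_m(y) any line on which one summand exceeds 1 will do.

Conversely T_(k a) = T_k o T_a, so u - v divides T_k(u) - T_k(v), u + v divides T_k(u) + T_k(v) for
odd k, and T_4(u) + T_4(v) splits into two real quadratics.
*)
theory Submission
  imports Defs
begin

section \<open>General facts on bivariate and on real polynomials\<close>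

lemma poly_const_map: "poly (map_poly (\<lambda>c. [:c:]) g) [:b:] = [:poly g b:]"
  for g :: "'a::comm_semiring_1 poly"
  by (induction g) (simp_all add: map_poly_pCons algebra_simps)

text \<open>A nonzero polynomial in y over the domain of polynomials in x has finitely many roots,
  while the constants \<open>[:b:]\<close> are infinitely many. Bivariate identities can thus be
  checked pointwise.\<close>

lemma poly_poly_ext:
  fixes p q :: "'a::{idom,ring_char_0} poly poly"
  assumes "\<And>a b. poly (poly p [:b:]) a = poly (poly q [:b:]) a"
  shows "p = q"
proof (rule ccontr)
  assume "p \<noteq> q"
  then have "finite {x. poly (p - q) x = 0}"
    by (intro poly_roots_finite) simp
  moreover have "range (\<lambda>b. [:b:]) \<subseteq> {x. poly (p - q) x = 0}"
    using assms by (auto intro!: poly_ext)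
  ultimately have "finite (range (\<lambda>b::'a. [:b:]))"
    by (rule rev_finite_subset)
  then have "finite (UNIV :: 'a set)"
    by (rule finite_imageD) (simp add: inj_on_def)
  then show False
    using infinite_UNIV_char_0 by blast
qed

lemma even_degree_if_no_real_root:
  fixes p :: "real poly"
  assumes "\<And>x. poly p x \<noteq> 0"
  shows "even (degree p)"
proof -
  have *: "even (degree p)" if lc: "lead_coeff p > 0" and nz: "\<And>x. poly p x \<noteq> 0" for p :: "real poly"
  proof (rule ccontr)
    assume odd: "odd (degree p)"
    \<comment> \<open>For odd degree, -p(-x) has the leading coefficient of p, so it is positive far
      to the right, and p is negative far to the left.\<close>
    define q where "q = - pcompose p [:0, -1:]"
    have "lead_coeff q = lead_coeff p"
      unfolding q_def using lead_coeff_comp[of "[:0, -1::real:]" p] odd by simp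
    then obtain l where l: "\<And>x. x \<ge> l \<Longrightarrow> poly q x \<ge> lead_coeff p"
      using poly_pinfty_gt_lc[of q] lc by auto
    obtain u where u: "\<And>x. x \<ge> u \<Longrightarrow> poly p x \<ge> lead_coeff p"
      using poly_pinfty_gt_lc lc by blast
    define r where "r = max 1 (max l u)"
    have "poly p (-r) < 0"
    proof -
      have "lead_coeff p \<le> poly q r"
        by (rule l) (simp add: r_def)
      then show ?thesis
        using lc by (simp add: q_def poly_pcompose)
    qed
    moreover have "poly p r > 0"
    proof -
      have "lead_coeff p \<le> poly p r"
        by (rule u) (simp add: r_def)
      then show ?thesis
        using lc by simp
    qed
    moreover have "-r < r" by (simp add: r_def)
    ultimately show False
      using poly_IVT_pos nz by blast
  qed
  have "p \<noteq> 0" using assms by auto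
  then consider "lead_coeff p > 0" | "lead_coeff (-p) > 0"
    by (metis lead_coeff_minus leading_coeff_0_iff linorder_neqE neg_0_less_iff_less)
  then show ?thesis
    using *[of p] *[of "-p"] assms by cases auto
qed

section \<open>Polynomials with separated variables\<close>

text \<open>Degree and leading coefficient in y are easy to read off in this form; differences are
  covered by negating g.\<close>

definition sep_poly :: "'a::comm_semiring_1 poly \<Rightarrow> 'a poly \<Rightarrow> 'a poly poly" where
  "sep_poly f g = [:f:] + map_poly (\<lambda>c. [:c:]) g"

lemma poly_sep_poly: "poly (poly (sep_poly f g) [:b:]) a = poly f a + poly g b"
  by (simp add: sep_poly_def poly_const_map)

lemma poly_sep_poly_const: "poly (sep_poly f g) [:b:] = f + [:poly g b:]"
  by (simp add: sep_poly_def poly_const_map)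

lemma degree_const_map: "degree (map_poly (\<lambda>c. [:c:]) g) = degree g"
  for g :: "'a::comm_semiring_1 poly"
  by (rule degree_map_poly) simp

lemma degree_sep_poly:
  assumes "degree g > 0"
  shows "degree (sep_poly f g) = degree g"
  unfolding sep_poly_def using assms
  by (subst degree_add_eq_right) (simp_all add: degree_const_map)

lemma lead_coeff_sep_poly:
  assumes "degree g > 0"
  shows "lead_coeff (sep_poly f g) = [:lead_coeff g:]"
  using assms unfolding degree_sep_poly[OF assms]
  by (simp add: sep_poly_def coeff_map_poly coeff_pCons split: nat.split)

text \<open>The shift of y by b keeps the separated form, so facts about the line y = 0 transfer to
  y = b.\<close>

lemma sep_poly_pcompose:
  fixes f g :: "'a::{idom,ring_char_0} poly"
  shows "pcompose (sep_poly f g) [:[:b:], 1:] = sep_poly f (pcompose g [:b, 1:])"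
  by (rule poly_poly_ext) (simp add: poly_sep_poly poly_pcompose)

section \<open>Degrees along the curves x = t^m, y = \<alpha> t^n\<close>

definition curve_subst :: "nat \<Rightarrow> nat \<Rightarrow> 'a::comm_ring_1 \<Rightarrow> 'a poly poly \<Rightarrow> 'a poly" where
  "curve_subst m n \<alpha> G =
    (\<Sum>i\<le>degree G. smult (\<alpha> ^ i) (monom 1 (n * i) * pcompose (coeff G i) (monom 1 m)))"

lemma poly_curve_subst:
  "poly (curve_subst m n \<alpha> G) t = poly (poly G [:\<alpha> * t ^ n:]) (t ^ m)"
  unfolding curve_subst_def poly_altdef[of G]
  by (simp add: poly_sum poly_pcompose poly_monom power_mult_distrib mult_ac flip: power_mult)

lemma curve_subst_mult:
  fixes G H :: "'a::{idom,ring_char_0} poly poly"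
  shows "curve_subst m n \<alpha> (G * H) = curve_subst m n \<alpha> G * curve_subst m n \<alpha> H"
  by (rule poly_ext) (simp add: poly_curve_subst)

text \<open>The coefficient of t^N on the curve, as a polynomial in \<alpha>: if it is not zero,
  only finitely many \<alpha> make that coefficient vanish.\<close>

definition curve_coeff :: "nat \<Rightarrow> nat \<Rightarrow> nat \<Rightarrow> 'a::comm_ring_1 poly poly \<Rightarrow> 'a poly" where
  "curve_coeff m n N G =
    (\<Sum>i\<le>degree G. monom (coeff (monom 1 (n * i) * pcompose (coeff G i) (monom 1 m)) N) i)"

lemma coeff_curve_subst: "coeff (curve_subst m n \<alpha> G) N = poly (curve_coeff m n N G) \<alpha>"
  unfolding curve_subst_def curve_coeff_def
  by (simp add: coeff_sum poly_sum poly_monom mult_ac)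

lemma coeff_curve_coeff:
  assumes "i \<le> degree G"
  shows "coeff (curve_coeff m n N G) i =
    coeff (monom 1 (n * i) * pcompose (coeff G i) (monom 1 m)) N"
  unfolding curve_coeff_def using assms by (simp add: coeff_sum)

lemma lead_coeff_pcompose_monom:
  fixes p :: "'a::idom poly"
  assumes "m > 0"
  shows "coeff (pcompose p (monom 1 m)) (m * degree p) = lead_coeff p"
  using lead_coeff_comp[of "monom (1::'a) m" p] assms
  by (simp add: degree_pcompose degree_monom_eq mult.commute)

text \<open>On the curve \<open>x = t\<^sup>m, y = \<alpha> t\<^sup>n\<close> a factor has, for generic \<open>\<alpha>\<close>, at least the degree
  contributed by its pure power of \<open>y\<close> and that contributed by its pure power of \<open>x\<close>.\<close>

lemma generic_degree_curve_subst:
  fixes G :: "'a::{idom,ring_char_0} poly poly"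
  assumes "m > 0" and lc: "lead_coeff G = [:c:]" "c \<noteq> 0" and nz: "poly G 0 \<noteq> 0"
  shows "finite {\<alpha>. \<not> (curve_subst m n \<alpha> G \<noteq> 0 \<and> n * degree G \<le> degree (curve_subst m n \<alpha> G) \<and>
    m * degree (poly G 0) \<le> degree (curve_subst m n \<alpha> G))}"
proof -
  define P where "P = curve_coeff m n (n * degree G) G"
  define Q where "Q = curve_coeff m n (m * degree (poly G 0)) G"
  \<comment> \<open>The top power of \<alpha> comes only from the leading term c y^(deg G), which
    becomes c \<alpha>^(deg G) t^(n deg G).\<close>
  have "coeff P (degree G) = c"
    unfolding P_def using lc by (simp add: coeff_curve_coeff coeff_monom_mult)
  then have "P \<noteq> 0" using lc by auto
  \<comment> \<open>The part free of \<alpha> is G(x, 0) at x = t^m.\<close>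
  have "coeff Q 0 = lead_coeff (poly G 0)"
    unfolding Q_def using lead_coeff_pcompose_monom[OF \<open>m > 0\<close>, of "poly G 0"]
    by (simp add: coeff_curve_coeff poly_0_coeff_0)
  then have "Q \<noteq> 0" using nz by auto
  have "finite ({\<alpha>. poly P \<alpha> = 0} \<union> {\<alpha>. poly Q \<alpha> = 0})"
    using \<open>P \<noteq> 0\<close> \<open>Q \<noteq> 0\<close> by (simp add: poly_roots_finite)
  then show ?thesis
    by (rule rev_finite_subset) (auto simp: P_def Q_def simp flip: coeff_curve_subst intro: le_degree)
qed

lemma factor_sep_poly_degree_0:
  fixes f g :: "'a::{idom,ring_char_0} poly"
  assumes pos: "degree f > 0" "degree g > 0" and GH: "sep_poly f g = G * H"
  shows "degree f * degree G = degree g * degree (poly G 0)"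
proof -
  define n where "n = degree f"
  define m where "m = degree g"
  have F0: "sep_poly f g \<noteq> 0"
    using pos degree_sep_poly[of g f] by auto
  then have nz: "G \<noteq> 0" "H \<noteq> 0" using GH by auto
  have degy: "degree G + degree H = m"
    using degree_sep_poly[OF pos(2), of f] nz by (simp add: GH m_def degree_mult_eq)
  have F0': "poly G 0 * poly H 0 = f + [:poly g 0:]"
    using poly_sep_poly_const[of f g 0] by (simp add: GH)
  have dF0: "degree (f + [:poly g 0:]) = n"
    using pos by (simp add: degree_add_eq_left n_def)
  then have nz0: "poly G 0 \<noteq> 0" "poly H 0 \<noteq> 0"
    using F0' pos by (auto simp: n_def)
  have degx: "degree (poly G 0) + degree (poly H 0) = n"
    using dF0 F0' degree_mult_eq[OF nz0] by simp
  \<comment> \<open>The product is a nonzero constant in x, so both factors are constants, as the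
    generic degree bound requires.\<close>
  have "lead_coeff G * lead_coeff H = [:lead_coeff g:]"
    using lead_coeff_sep_poly[OF pos(2), of f] by (simp add: GH lead_coeff_mult)
  moreover from this have "degree (lead_coeff G) + degree (lead_coeff H) = 0"
    using nz degree_mult_eq[of "lead_coeff G" "lead_coeff H"] by simp
  ultimately obtain c c' where c: "lead_coeff G = [:c:]" "lead_coeff H = [:c':]"
    by (auto elim!: degree_eq_zeroE)
  then have c0: "c \<noteq> 0" "c' \<noteq> 0" using nz by auto
  have "m > 0" using pos by (simp add: m_def)
  \<comment> \<open>Each factor excludes only finitely many \<alpha>, so one value suits
    both.\<close>
  obtain \<alpha> where
    \<alpha>: "curve_subst m n \<alpha> G \<noteq> 0" "n * degree G \<le> degree (curve_subst m n \<alpha> G)"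
      "m * degree (poly G 0) \<le> degree (curve_subst m n \<alpha> G)"
      "curve_subst m n \<alpha> H \<noteq> 0" "n * degree H \<le> degree (curve_subst m n \<alpha> H)"
      "m * degree (poly H 0) \<le> degree (curve_subst m n \<alpha> H)"
    using ex_new_if_finite[OF infinite_UNIV_char_0 finite_UnI[OF
        generic_degree_curve_subst[OF \<open>m > 0\<close> c(1) c0(1) nz0(1)]
        generic_degree_curve_subst[OF \<open>m > 0\<close> c(2) c0(2) nz0(2)]], of n n] by blast
  have "curve_subst m n \<alpha> (sep_poly f g) = pcompose f (monom 1 m) + pcompose g (monom \<alpha> n)"
    by (rule poly_ext) (simp add: poly_curve_subst poly_sep_poly poly_pcompose poly_monom)
  also have "degree \<dots> \<le> n * m"
  proof (rule degree_add_le)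
    show "degree (pcompose f (monom 1 m)) \<le> n * m"
      by (simp add: degree_pcompose degree_monom_eq n_def)
    show "degree (pcompose g (monom \<alpha> n)) \<le> n * m"
      using degree_monom_le[of \<alpha> n] by (simp add: degree_pcompose m_def mult.commute)
  qed
  finally have up: "degree (curve_subst m n \<alpha> G) + degree (curve_subst m n \<alpha> H) \<le> n * m"
    using \<alpha> by (simp add: GH curve_subst_mult degree_mult_eq)
  \<comment> \<open>Both pairs of lower bounds for G and H sum to nm, the upper bound for the
    product. Hence all bounds are equalities, and the two for G agree.\<close>
  have "n * m = n * degree G + n * degree H" "n * m = m * degree (poly G 0) + m * degree (poly H 0)"
    by (simp_all flip: degx degy add: algebra_simps)
  with up \<alpha> have "n * degree G = m * degree (poly G 0)"
    by linarith
  then show ?thesis by (simp add: n_def m_def)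
qed

lemma factor_sep_poly_degree:
  fixes f g :: "'a::{idom,ring_char_0} poly"
  assumes "degree f > 0" "degree g > 0" and GH: "sep_poly f g = G * H"
  shows "degree f * degree G = degree g * degree (poly G [:b:])"
proof -
  have "sep_poly f (pcompose g [:b, 1:]) = pcompose G [:[:b:], 1:] * pcompose H [:[:b:], 1:]"
    by (simp add: GH flip: sep_poly_pcompose pcompose_mult)
  from factor_sep_poly_degree_0[OF _ _ this] assms show ?thesis
    by (simp add: degree_pcompose poly_pcompose)
qed

section \<open>Irreducibility criteria for f(x) + g(y)\<close>

lemma irreducible_sep_polyI:
  fixes f g :: "'a::field_char_0 poly"
  assumes pos: "degree g > 0"
    and "\<And>G H. sep_poly f g = G * H \<Longrightarrow> degree G = 0 \<or> degree H = 0"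
  shows "irreducible (sep_poly f g)"
proof (rule irreducibleI)
  \<comment> \<open>A factor free of y divides the leading coefficient in y, which is a nonzero
    constant.\<close>
  have unit: "is_unit G" if GH: "sep_poly f g = G * H" "degree G = 0" for G H :: "'a poly poly"
  proof -
    obtain u where u: "G = [:u:]"
      using GH(2) by (meson degree_eq_zeroE)
    have "lead_coeff G * lead_coeff H = [:lead_coeff g:]"
      using lead_coeff_sep_poly[OF pos, of f] by (simp add: GH(1) lead_coeff_mult)
    then have "u * lead_coeff H = [:lead_coeff g:]"
      by (simp add: u)
    moreover have "is_unit [:lead_coeff g:]"
      using pos by (subst is_unit_const_poly_iff) (auto simp: dvd_field_iff)
    ultimately have "is_unit u"
      by (metis dvd_triv_left dvd_trans)
    then show ?thesis using u by (simp add: is_unit_const_poly_iff)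
  qed
  show "sep_poly f g \<noteq> 0"
    using degree_sep_poly[OF pos, of f] pos by auto
  show "\<not> is_unit (sep_poly f g)"
    using degree_sep_poly[OF pos, of f] pos by (auto simp: is_unit_poly_iff)
  fix G H assume "sep_poly f g = G * H"
  then show "is_unit G \<or> is_unit H"
    using assms(2)[of G H] unit[of G H] unit[of H G] by (auto simp: mult.commute)
qed

lemma degree_add_factors_sep_poly:
  fixes f g :: "'a::{idom,ring_char_0} poly"
  assumes "degree g > 0" "sep_poly f g = G * H"
  shows "degree G + degree H = degree g"
proof -
  have "G * H \<noteq> 0"
    using assms degree_sep_poly[of g f] by auto
  then show ?thesis
    using assms degree_sep_poly[of g f] by (simp add: degree_mult_eq)
qed

text \<open>Coprimality and the degree relation make deg g divide deg G, and deg G is at most deg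
  g.\<close>

lemma irreducible_sep_poly_coprime:
  fixes f g :: "'a::field_char_0 poly"
  assumes "degree f > 0" "degree g > 0" "coprime (degree f) (degree g)"
  shows "irreducible (sep_poly f g)"
proof (rule irreducible_sep_polyI)
  fix G H assume GH: "sep_poly f g = G * H"
  have "degree g dvd degree f * degree G"
    by (simp add: factor_sep_poly_degree_0[OF assms(1,2) GH])
  then have "degree g dvd degree G"
    using assms(3) by (simp add: coprime_commute coprime_dvd_mult_right_iff)
  then show "degree G = 0 \<or> degree H = 0"
    using degree_add_factors_sep_poly[OF assms(2) GH] dvd_imp_le[of "degree g" "degree G"] by linarith
qed fact

text \<open>Restricted to a line \<open>x = x\<^sub>0\<close> or \<open>y = y\<^sub>0\<close> that misses the real curve, a factor has no real
  root, so it has even degree there.\<close>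

lemma irreducible_sep_poly_gcd_2:
  fixes f g :: "real poly"
  assumes pos: "degree f > 0" "degree g > 0" and gcd: "gcd (degree f) (degree g) = 2"
    and x0: "\<And>y. poly f x0 + poly g y \<noteq> 0" and y0: "\<And>x. poly f x + poly g y0 \<noteq> 0"
  shows "irreducible (sep_poly f g)"
proof (rule irreducible_sep_polyI)
  fix G H assume GH: "sep_poly f g = G * H"
  obtain a b where ab: "degree f = 2 * a" "degree g = 2 * b" "coprime a b"
    using gcd gcd_coprime_exists[of "degree f" "degree g"] by (auto simp: mult.commute)
  note eq = factor_sep_poly_degree[OF pos GH, of y0]
  have no_root: "poly (poly G [:y:]) x \<noteq> 0" if "poly f x + poly g y \<noteq> 0" for x y
    using poly_sep_poly[of f g y x] that by (auto simp: GH)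
  have "even (degree (poly G [:y0:]))"
    by (intro even_degree_if_no_real_root no_root y0)
  moreover have "even (degree G)"
  proof -
    \<comment> \<open>The restriction of G to the line x = \<open>x0\<close>. It keeps the y-degree
      because the leading coefficient of G does not vanish there.\<close>
    define p where "p = map_poly (\<lambda>q. poly q x0) G"
    have p: "poly p y = poly (poly G [:y:]) x0" for y
      unfolding p_def by (induction G) (simp_all add: map_poly_pCons)
    have "lead_coeff G * lead_coeff H = [:lead_coeff g:]"
      using lead_coeff_sep_poly[OF pos(2), of f] by (simp add: GH lead_coeff_mult)
    then have "poly (lead_coeff G) x0 * poly (lead_coeff H) x0 = lead_coeff g"
      by (simp flip: poly_mult)
    moreover have "lead_coeff g \<noteq> 0"
      using pos by auto
    ultimately have "poly (lead_coeff G) x0 \<noteq> 0"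
      by auto
    then have "degree p = degree G"
      unfolding p_def by (rule map_poly_degree_eq)
    moreover have "even (degree p)"
      by (intro even_degree_if_no_real_root) (simp add: p no_root x0)
    ultimately show ?thesis by simp
  qed
  ultimately obtain k j where kj: "degree G = 2 * k" "degree (poly G [:y0:]) = 2 * j"
    by (meson evenE)
  \<comment> \<open>Evenness of both degrees cancels the common factor 2. Without it only b would be
    known to divide deg G, allowing deg G = b.\<close>
  have "a * k = b * j"
    using eq by (simp add: ab kj)
  then have "b dvd k"
    using ab(3) by (metis coprime_commute coprime_dvd_mult_right_iff dvd_triv_left)
  then have "degree g dvd degree G"
    by (simp add: ab kj)
  then show "degree G = 0 \<or> degree H = 0"
    using degree_add_factors_sep_poly[OF pos(2) GH] dvd_imp_le[of "degree g" "degree G"] by linarith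
qed fact

section \<open>Chebyshev polynomials\<close>

lemma chebyshev_T_eqI:
  assumes "\<And>\<theta>. poly p (cos \<theta>) = cos (real k * \<theta>)"
  shows "chebyshev_T k = p"
  using chebyshev_T_unique[of "chebyshev_T k" k p] assms poly_chebyshev_T_cos by blast

lemma chebyshev_T_0: "chebyshev_T 0 = 1"
  and chebyshev_T_1: "chebyshev_T (Suc 0) = [:0, 1:]"
  and chebyshev_T_2: "chebyshev_T 2 = [:-1, 0, 2:]"
  by (intro chebyshev_T_eqI; simp add: cos_double_cos power2_eq_square)+

lemma chebyshev_T_rec: "chebyshev_T (Suc (Suc k)) = [:0, 2:] * chebyshev_T (Suc k) - chebyshev_T k"
proof (rule chebyshev_T_eqI)
  fix \<theta> :: real
  have "cos (real (Suc (Suc k)) * \<theta>) + cos (real k * \<theta>)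
      = cos (real (Suc k) * \<theta> + \<theta>) + cos (real (Suc k) * \<theta> - \<theta>)"
    by (simp add: algebra_simps)
  also have "\<dots> = 2 * cos \<theta> * cos (real (Suc k) * \<theta>)"
    unfolding cos_add cos_diff by simp
  finally show "poly ([:0, 2:] * chebyshev_T (Suc k) - chebyshev_T k) (cos \<theta>)
      = cos (real (Suc (Suc k)) * \<theta>)"
    by (simp add: poly_chebyshev_T_cos del: of_nat_Suc)
qed

text \<open>Both sides take cos \<theta> to cos(k l \<theta>). This composition law underlies all
  factorizations below.\<close>

lemma chebyshev_T_mult: "chebyshev_T (k * l) = pcompose (chebyshev_T k) (chebyshev_T l)"
  by (rule chebyshev_T_eqI) (simp add: poly_pcompose poly_chebyshev_T_cos mult.assoc)

lemma degree_chebyshev_T [simp]: "degree (chebyshev_T k) = k"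
proof -
  \<comment> \<open>The recurrence reaches back two steps, so consecutive pairs are carried through
    the induction.\<close>
  have "degree (chebyshev_T k) = k \<and> degree (chebyshev_T (Suc k)) = Suc k"
  proof (induction k)
    case 0
    then show ?case by (simp add: chebyshev_T_0 chebyshev_T_1)
  next
    case (Suc k)
    have "chebyshev_T (Suc k) \<noteq> 0" using Suc by auto
    then have "degree ([:0, 2:] * chebyshev_T (Suc k)) = Suc (Suc k)"
      using Suc by (simp add: degree_mult_eq del: mult_pCons_left)
    then have "degree (chebyshev_T (Suc (Suc k))) = Suc (Suc k)"
      unfolding chebyshev_T_rec diff_conv_add_uminus using Suc
      by (subst degree_add_eq_left) simp_all
    with Suc show ?case by simp
  qed
  then show ?thesis ..
qed

lemma poly_chebyshev_T_minus:
  assumes "odd k"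
  shows "poly (chebyshev_T k) (-x) = - poly (chebyshev_T k) x"
proof -
  have "cos (real k * pi) = -1" "sin (real k * pi) = 0"
    using assms by (simp_all add: cos_npi sin_npi)
  then have "cos (real k * (\<theta> + pi)) = - cos (real k * \<theta>)" for \<theta>
    by (simp add: distrib_left cos_add)
  then have "poly (chebyshev_T k) (cos (\<theta> + pi)) = - cos (real k * \<theta>)" for \<theta>
    unfolding poly_chebyshev_T_cos .
  \<comment> \<open>Uniqueness turns the identity on cosines into one of polynomials, hence valid
    also outside [-1, 1].\<close>
  then have "chebyshev_T k = - pcompose (chebyshev_T k) [:0, -1:]"
    by (intro chebyshev_T_eqI) (simp add: poly_pcompose)
  then have "poly (chebyshev_T k) x = poly (- pcompose (chebyshev_T k) [:0, -1:]) x"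
    by simp
  then show ?thesis
    by (simp add: poly_pcompose)
qed

lemma chebyshev_T_unbounded:
  assumes "k > 0"
  shows "\<exists>x. \<bar>poly (chebyshev_T k) x\<bar> > 1"
proof -
  obtain a p where p: "chebyshev_T k = pCons a p"
    by (meson pCons_cases)
  then have "p \<noteq> 0"
    using assms degree_chebyshev_T[of k] by auto
  from poly_infinity[OF this, of 2 a] obtain r where
    r: "\<And>z. r \<le> \<bar>z\<bar> \<Longrightarrow> 2 \<le> \<bar>poly (chebyshev_T k) z\<bar>"
    unfolding p by auto
  have "\<bar>poly (chebyshev_T k) \<bar>r\<bar>\<bar> \<ge> 2"
    by (rule r) simp
  then show ?thesis
    by (intro exI[of _ "\<bar>r\<bar>"]) linarith
qed

section \<open>Reducibility through explicit factors\<close>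

lemma diff_dvd_poly_diff: "a - b dvd poly p a - poly p b"
  for a b :: "'a::comm_ring_1"
proof (induction p)
  case (pCons c p)
  have "poly (pCons c p) a - poly (pCons c p) b = (a - b) * poly p a + b * (poly p a - poly p b)"
    by (simp add: algebra_simps)
  then show ?case using pCons by (metis dvd_add dvd_mult dvd_triv_left)
qed simp

text \<open>The cofactor of D also has positive y-degree, whereas units have degree 0.\<close>

lemma not_irreducible_sep_poly:
  fixes f g :: "'a::field poly"
  assumes "D dvd sep_poly f g" "0 < degree D" "degree D < degree g"
  shows "\<not> irreducible (sep_poly f g)"
proof
  assume irr: "irreducible (sep_poly f g)"
  obtain E where E: "sep_poly f g = D * E" using assms(1) by blast
  have "degree (D * E) = degree g"
    using degree_sep_poly[of g f] assms by (simp add: E)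
  moreover have "D \<noteq> 0" using assms by auto
  ultimately have "degree E > 0"
    using assms by (cases "E = 0") (auto simp: degree_mult_eq)
  moreover have "is_unit D \<or> is_unit E"
    using irr E by (simp add: irreducible_def)
  ultimately show False using assms by (auto simp: is_unit_poly_iff)
qed

lemma subst2_eq_sep_poly:
  "subst2 p var_x + subst2 q var_y = sep_poly p q"
  "subst2 p var_x - subst2 q var_y = sep_poly p (- q)"
  by (rule poly_poly_ext; simp add: poly_subst2 poly_sep_poly var_x_def var_y_def)+

lemma not_irreducible_chebyshev_diff:
  assumes "k > 1" "a > 0" "b > 0"
  shows "\<not> irreducible (sep_poly (chebyshev_T (k * a)) (- chebyshev_T (k * b)))"
proof (rule not_irreducible_sep_poly)
  define D where "D = sep_poly (chebyshev_T a) (- chebyshev_T b)"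
  \<comment> \<open>With u = T_a(x) and v = T_b(y) this is T_k(u) - T_k(v), a multiple of u -
    v.\<close>
  have "sep_poly (chebyshev_T (k * a)) (- chebyshev_T (k * b)) =
      subst2 (chebyshev_T k) (sep_poly (chebyshev_T a) 0) -
      subst2 (chebyshev_T k) (sep_poly 0 (chebyshev_T b))"
    by (rule poly_poly_ext) (simp add: poly_subst2 poly_sep_poly chebyshev_T_mult poly_pcompose)
  moreover have "D = sep_poly (chebyshev_T a) 0 - sep_poly 0 (chebyshev_T b)"
    by (rule poly_poly_ext) (simp add: D_def poly_sep_poly)
  ultimately show "D dvd sep_poly (chebyshev_T (k * a)) (- chebyshev_T (k * b))"
    by (simp add: subst2_def diff_dvd_poly_diff)
  have "degree D = b"
    using assms unfolding D_def by (subst degree_sep_poly) simp_all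
  then show "0 < degree D" "degree D < degree (- chebyshev_T (k * b))"
    using assms by simp_all
qed

lemma not_irreducible_chebyshev_sum_odd:
  assumes "odd k" "k > 1" "a > 0" "b > 0"
  shows "\<not> irreducible (sep_poly (chebyshev_T (k * a)) (chebyshev_T (k * b)))"
proof (rule not_irreducible_sep_poly)
  define D where "D = sep_poly (chebyshev_T a) (chebyshev_T b)"
  \<comment> \<open>Since \<open>T_k\<close> is odd, T_k(u) + T_k(v) = T_k(u) - T_k(-v), a multiple
    of u + v.\<close>
  have "sep_poly (chebyshev_T (k * a)) (chebyshev_T (k * b)) =
      subst2 (chebyshev_T k) (sep_poly (chebyshev_T a) 0) -
      subst2 (chebyshev_T k) (sep_poly 0 (- chebyshev_T b))"
    using assms(1) by (intro poly_poly_ext)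
      (simp add: poly_subst2 poly_sep_poly chebyshev_T_mult poly_pcompose poly_chebyshev_T_minus)
  moreover have "D = sep_poly (chebyshev_T a) 0 - sep_poly 0 (- chebyshev_T b)"
    by (rule poly_poly_ext) (simp add: D_def poly_sep_poly)
  ultimately show "D dvd sep_poly (chebyshev_T (k * a)) (chebyshev_T (k * b))"
    by (simp add: subst2_def diff_dvd_poly_diff)
  have "degree D = b"
    using assms unfolding D_def by (subst degree_sep_poly) simp_all
  then show "0 < degree D" "degree D < degree (chebyshev_T (k * b))"
    using assms by simp_all
qed

text \<open>\<open>T\<^sub>4(u) + T\<^sub>4(v) = 8 (u\<^sup>2 + v\<^sup>2 - \<surd>2 u v - 1/2) (u\<^sup>2 + v\<^sup>2 + \<surd>2 u v - 1/2)\<close>.\<close>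

lemma not_irreducible_chebyshev_sum_4:
  assumes "a > 0" "b > 0"
  shows "\<not> irreducible (sep_poly (chebyshev_T (4 * a)) (chebyshev_T (4 * b)))"
proof (rule not_irreducible_sep_poly)
  define u where "u = sep_poly (chebyshev_T a) 0"
  define v where "v = sep_poly 0 (chebyshev_T b)"
  define D where "D s = u\<^sup>2 + v\<^sup>2 + [:[:s:]:] * u * v - [:[:1/2:]:]" for s :: real
  have T4: "poly (chebyshev_T (4 * k)) x = 8 * (poly (chebyshev_T k) x) ^ 4
      - 8 * (poly (chebyshev_T k) x)\<^sup>2 + 1" for k and x :: real
  proof -
    have "chebyshev_T (4 * k) = chebyshev_T (2 * (2 * k))" by simp
    then show ?thesis
      by (simp only: chebyshev_T_mult chebyshev_T_2 poly_pcompose)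
        (simp add: algebra_simps power2_eq_square power4_eq_xxxx)
  qed
  \<comment> \<open>A difference of squares: s^2 = 2 makes the mixed terms in p^2 q^2
    cancel.\<close>
  have factor: "8 * p ^ 4 - 8 * p\<^sup>2 + 1 + (8 * q ^ 4 - 8 * q\<^sup>2 + 1) =
      (p\<^sup>2 + q\<^sup>2 + s * p * q - 1/2) * (8 * (p\<^sup>2 + q\<^sup>2 - s * p * q - 1/2))" if "s\<^sup>2 = 2" for p q s :: real
  proof -
    have "(p\<^sup>2 + q\<^sup>2 + s * p * q - 1/2) * (8 * (p\<^sup>2 + q\<^sup>2 - s * p * q - 1/2)) =
        8 * ((p\<^sup>2 + q\<^sup>2 - 1/2)\<^sup>2 - s\<^sup>2 * p\<^sup>2 * q\<^sup>2)"
      by (simp add: algebra_simps power2_eq_square)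
    also have "\<dots> = 8 * p ^ 4 - 8 * p\<^sup>2 + 1 + (8 * q ^ 4 - 8 * q\<^sup>2 + 1)"
      unfolding that by (simp add: algebra_simps power2_eq_square power4_eq_xxxx)
    finally show ?thesis ..
  qed
  have "sep_poly (chebyshev_T (4 * a)) (chebyshev_T (4 * b)) =
      D (sqrt 2) * ([:[:8:]:] * D (- sqrt 2))"
  proof (rule poly_poly_ext)
    fix x y
    have D: "poly (poly (D s) [:y:]) x = (poly (chebyshev_T a) x)\<^sup>2 + (poly (chebyshev_T b) y)\<^sup>2
        + s * poly (chebyshev_T a) x * poly (chebyshev_T b) y - 1/2" for s
      by (simp add: D_def u_def v_def poly_sep_poly)
    show "poly (poly (sep_poly (chebyshev_T (4 * a)) (chebyshev_T (4 * b))) [:y:]) x =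
        poly (poly (D (sqrt 2) * ([:[:8:]:] * D (- sqrt 2))) [:y:]) x"
      unfolding poly_sep_poly T4 factor[of "sqrt 2", OF real_sqrt_pow2[of 2, OF zero_le_numeral]]
        poly_mult D by simp
  qed
  then show "D (sqrt 2) dvd sep_poly (chebyshev_T (4 * a)) (chebyshev_T (4 * b))"
    by (simp only: dvd_triv_left)
  have v: "degree v = b"
    using assms unfolding v_def by (subst degree_sep_poly) simp_all
  have u: "u = [:chebyshev_T a:]"
    by (simp add: u_def sep_poly_def)
  \<comment> \<open>Sorted by powers of v: v^2 has y-degree 2b, the rest at most b.\<close>
  have "D (sqrt 2) =
      v\<^sup>2 + (smult [:sqrt 2:] (smult (chebyshev_T a) v) + [:(chebyshev_T a)\<^sup>2 - [:1/2:]:])"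
    by (simp add: D_def u power2_eq_square algebra_simps)
  moreover have "degree (v\<^sup>2) = 2 * b"
    using v assms by (subst degree_power_eq) auto
  moreover have "degree (smult [:sqrt 2:] (smult (chebyshev_T a) v) + [:(chebyshev_T a)\<^sup>2 - [:1/2:]:]) \<le> b"
    using v by (intro degree_add_le) simp_all
  ultimately have "degree (D (sqrt 2)) = 2 * b"
    using assms by (simp add: degree_add_eq_left)
  then show "0 < degree (D (sqrt 2))" "degree (D (sqrt 2)) < degree (chebyshev_T (4 * b))"
    using assms by simp_all
qed

text \<open>By T_2k = 2 T_k^2 - 1, both summands are at least -1 everywhere and exceed 1 somewhere,
  which supplies lines on which the sum stays positive.\<close>

lemma irreducible_chebyshev_sum_gcd_2:
  assumes "m > 0" "n > 0" "gcd m n = 2"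
  shows "irreducible (sep_poly (chebyshev_T n) (chebyshev_T m))"
proof -
  obtain a b where ab: "n = 2 * a" "m = 2 * b"
    using assms(3) by (metis dvdE gcd_dvd1 gcd_dvd2)
  then have pos: "a > 0" "b > 0" using assms by auto
  have T2: "poly (chebyshev_T (2 * k)) x = 2 * (poly (chebyshev_T k) x)\<^sup>2 - 1" for k x
    by (simp add: chebyshev_T_mult chebyshev_T_2 poly_pcompose power2_eq_square)
  have large: "\<exists>x. poly (chebyshev_T (2 * k)) x > 1" if "k > 0" for k
  proof -
    from chebyshev_T_unbounded[OF that] obtain x where "\<bar>poly (chebyshev_T k) x\<bar> > 1"
      by blast
    then have "(poly (chebyshev_T k) x)\<^sup>2 > 1"
      using power_strict_mono[of 1 "\<bar>poly (chebyshev_T k) x\<bar>" 2] by simp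
    then show ?thesis by (auto simp: T2)
  qed
  have ge: "poly (chebyshev_T (2 * k)) x \<ge> -1" for k x
    by (simp add: T2)
  obtain x0 y0 where "poly (chebyshev_T (2 * a)) x0 > 1" "poly (chebyshev_T (2 * b)) y0 > 1"
    using large pos by blast
  then have "poly (chebyshev_T n) x0 + poly (chebyshev_T m) y \<noteq> 0"
    "poly (chebyshev_T n) x + poly (chebyshev_T m) y0 \<noteq> 0" for x y
    using ge[of b y] ge[of a x] by (auto simp: ab)
  then show ?thesis
    using assms by (intro irreducible_sep_poly_gcd_2[of _ _ x0 y0]) (simp_all add: gcd.commute)
qed

section \<open>Case distinction on the gcd\<close>

theorem theorem6:
  fixes m n d :: nat
  assumes "m > 0" and "n > 0" and "d = gcd m n"
  shows "(irreducible (subst2 (chebyshev_T n) var_x - subst2 (chebyshev_T m) var_y) \<longleftrightarrow> d = 1) \<and>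
         (irreducible (subst2 (chebyshev_T n) var_x + subst2 (chebyshev_T m) var_y) \<longleftrightarrow> d \<le> 2)"
proof -
  have "d > 0" using assms by simp
  have split: "\<exists>a b. n = k * a \<and> m = k * b \<and> a > 0 \<and> b > 0" if "k dvd d" for k
  proof -
    have "k dvd n" "k dvd m"
      using that assms(3) by auto
    then obtain a b where "n = k * a" "m = k * b"
      by (meson dvdE)
    then show ?thesis using assms(1,2) by auto
  qed
  have irr1: "irreducible (sep_poly (chebyshev_T n) (chebyshev_T m))"
    "irreducible (sep_poly (chebyshev_T n) (- chebyshev_T m))" if "d = 1"
  proof -
    have "coprime m n"
      using assms(3) that by (metis coprime_iff_gcd_eq_1)
    then have "coprime n m"
      by (simp only: coprime_commute)
    then show "irreducible (sep_poly (chebyshev_T n) (chebyshev_T m))"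
      "irreducible (sep_poly (chebyshev_T n) (- chebyshev_T m))"
      using assms(1,2) by (simp_all add: irreducible_sep_poly_coprime)
  qed
  have "\<not> irreducible (sep_poly (chebyshev_T n) (- chebyshev_T m))" if "d \<noteq> 1"
    using split[of d] that \<open>d > 0\<close> not_irreducible_chebyshev_diff[of d] by auto
  moreover have "irreducible (sep_poly (chebyshev_T n) (chebyshev_T m))" if "d = 2"
    using irreducible_chebyshev_sum_gcd_2 that assms by simp
  moreover have "\<not> irreducible (sep_poly (chebyshev_T n) (chebyshev_T m))" if "d > 2"
  proof -
    \<comment> \<open>If d is odd, take k = d; if d = 2e with e odd, take k = e, which exceeds 1 as
      d > 2; otherwise 4 divides d.\<close>
    consider k where "odd k" "k > 1" "k dvd d" | "4 dvd d"
    proof (cases "odd d")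
      case True
      then show ?thesis using that(1)[of d] \<open>d > 2\<close> by simp
    next
      case False
      then obtain e where e: "d = 2 * e" by blast
      show ?thesis
      proof (cases "odd e")
        case True
        then show ?thesis using that(1)[of e] \<open>d > 2\<close> e by simp
      next
        case False
        then show ?thesis using that(2) e by auto
      qed
    qed
    then show ?thesis
    proof cases
      case 1
      then show ?thesis
        using split[of k] not_irreducible_chebyshev_sum_odd by blast
    next
      case 2
      then show ?thesis
        using split[of 4] not_irreducible_chebyshev_sum_4 by blast
    qed
  qed
  moreover have "d \<le> 2 \<longleftrightarrow> d = 1 \<or> d = 2"
    using \<open>d > 0\<close> by auto
  ultimately show ?thesis
    unfolding subst2_eq_sep_poly using irr1 by (cases "d = 1"; cases "d = 2") auto
qed

end
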